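(* Let $m\ge 1$ be an integer, let $\mathbf{n}=(n_1,\dots,n_m)\in\mathbb{C}^m$ with $\mathrm{Re}(n_i)>-1$ for all $i$, and let $N=\sum_{i=1}^m n_i$. Let $S(\mathbf{p})=-\sum_{i=1}^m p_i\log(p_i)$ be the Shannon entropy. Then the Bayes estimator with uniform prior for $S(\mathbf{p})^2$, namely $S_2/S_0 := I[S(\mathbf{p})^2,\mathbf{n}]/I[1,\mathbf{n}]$, is given by $$\frac{S_2}{S_0} = \sum_{i\neq j}\frac{(n_i+1)(n_j+1)}{(N+m)(N+m+1)}\Big\{\Delta\Phi^{(1)}(n_i+2,N+m+2)\,\Delta\Phi^{(1)}(n_j+2,N+m+2)-\Phi^{(2)}(N+m+2)\Big\}$$ $$\qquad+\sum_{i}\frac{(n_i+1)(n_i+2)}{(N+m)(N+m+1)}\Big\{\big(\Delta\Phi^{(1)}(n_i+3,N+m+2)\big)^2+\Delta\Phi^{(2)}(n_i+3,N+m+2)\Big\},$$ where the first sum is over ordered pairs $(i,j)$ with $1\le i,j\le m$, $i\ne j$, and the second over $1\le i\le m$.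
   Context: For a function $F$ on the simplex $\{\mathbf{p}\in\mathbb{R}^m: p_i\ge 0\ \forall i,\ \sum_i p_i=1\}$ and $\mathbf{n}\in\mathbb{C}^m$, define $I[F(\mathbf{p}),\mathbf{n}] = \int d\mathbf{p}\,F(\mathbf{p})\,\delta\big(\sum_i p_i-1\big)\prod_i\theta(p_i)\prod_{i=1}^m p_i^{n_i}$, where $\theta(x)=1$ for $x\ge0$ and $0$ otherwise. Explicitly, this is the Lebesgue integral of $F(\mathbf{p})\prod_{i=1}^m p_i^{n_i}$ over $\{(p_1,\dots,p_{m-1}): p_i\ge 0,\ \sum_{i=1}^{m-1}p_i\le 1\}$ with respect to $dp_1\cdots dp_{m-1}$, with $p_m=1-\sum_{i=1}^{m-1}p_i$ (for $m=1$ it is the value of the integrand at $p_1=1$). Here $p^{n}=e^{n\log p}$ for $p>0$ and $\log$ is the natural logarithm. For $n\ge1$ and $\mathrm{Re}(z)>0$, $\Phi^{(n)}(z)=\partial_z^{n}\log\Gamma(z)$ (so $\Phi^{(1)}=\Gamma'/\Gamma$ is the digamma function and $\Phi^{(n)}$ is the $(n-1)$-st derivative of $\Phi^{(1)}$), and $\Delta\Phi^{(n)}(z_1,z_2)=\Phi^{(n)}(z_1)-\Phi^{(n)}(z_2)$. *)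

theory Defs
  imports "HOL-Analysis.Analysis"
begin

text \<open>
  A point of the simplex is a function on the index set \<open>{1..m}\<close>, determined by its
  first \<open>m - 1\<close> coordinates.
\<close>

definition simplex_point :: "nat \<Rightarrow> (nat \<Rightarrow> real) \<Rightarrow> nat \<Rightarrow> real" where
  "simplex_point m x = x(m := 1 - (\<Sum>i\<in>{1..<m}. x i))"

text \<open>
  The functional \<open>I[F(p), n]\<close>, with the delta function resolved by eliminating the last
  coordinate. For \<open>m = 1\<close> the product measure over the empty index set is a unit point
  mass, so the integral is the value of the integrand at \<open>p 1 = 1\<close>. For a positive real
  \<open>p\<close>, \<open>of_real p powr c\<close> is \<open>exp (c * of_real (ln p))\<close>.
\<close>

definition simplex_integral ::
  "nat \<Rightarrow> ((nat \<Rightarrow> real) \<Rightarrow> complex) \<Rightarrow> (nat \<Rightarrow> complex) \<Rightarrow> complex" where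
  "simplex_integral m F n =
     set_lebesgue_integral (Pi\<^sub>M {1..<m} (\<lambda>_. lborel))
       {x. (\<forall>i\<in>{1..<m}. 0 \<le> x i) \<and> (\<Sum>i\<in>{1..<m}. x i) \<le> 1}
       (\<lambda>x. F (simplex_point m x) *
            (\<Prod>i\<in>{1..m}. of_real (simplex_point m x i) powr n i))"

text \<open>The convention \<open>0 * log 0 = 0\<close> holds by \<open>ln 0 = 0\<close>.\<close>

definition shannon_entropy :: "nat \<Rightarrow> (nat \<Rightarrow> real) \<Rightarrow> real" where
  "shannon_entropy m p = - (\<Sum>i\<in>{1..m}. p i * ln (p i))"

text \<open>
  \<open>ln_Gamma\<close> is the branch of the logarithm of \<open>Gamma\<close> that is holomorphic off the
  nonpositive real axis, in contrast to \<open>Ln (Gamma z)\<close>, which jumps.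
\<close>

definition Phi :: "nat \<Rightarrow> complex \<Rightarrow> complex" where
  "Phi k z = (deriv ^^ k) ln_Gamma z"

definition Delta_Phi :: "nat \<Rightarrow> complex \<Rightarrow> complex \<Rightarrow> complex" where
  "Delta_Phi k z w = Phi k z - Phi k w"

end

theory Submission
  imports Defs "HOL-Complex_Analysis.Conformal_Mappings"
begin

text \<open>
  For real exponents, \<open>I[1, n]\<close> is the Dirichlet integral
  \<open>(\<Prod>i. Gamma (n i + 1)) / Gamma (N + m)\<close>, obtained by integrating out one coordinate after
  another with the Beta integral. Both sides are holomorphic in each exponent, so the identity
  theorem, applied to one exponent at a time, extends the formula to complex exponents.
  Differentiating the integral in \<open>n i\<close> inserts a factor \<open>ln (p i)\<close>, so the second logarithmic
  moments are the second partial derivatives of the Gamma quotient. In \<open>S(p)\<^sup>2\<close>, which is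
  \<open>\<Sum>i j. p i * p j * ln (p i) * ln (p j)\<close>, the factors \<open>p i\<close> and \<open>p j\<close> raise two exponents by
  one; the functional equation of Gamma turns this into the rational prefactors.
\<close>

section \<open>Differentiation of a parameter integral\<close>

text \<open>Mean value inequality on the disc of radius \<open>norm w\<close>, where the derivative
  of \<open>exp\<close> is bounded by \<open>exp (norm w)\<close>. It dominates the difference
  quotients below.\<close>

lemma norm_exp_minus_one_le: "norm (exp w - 1 :: complex) \<le> norm w * exp (norm w)"
proof -
  have "norm (exp w - exp 0) \<le> exp (norm w) * norm (w - 0)"
  proof (rule field_differentiable_bound[of "cball 0 (norm w)" _ exp])
    show "norm (exp z) \<le> exp (norm w)" if "z \<in> cball 0 (norm w)" for z
      using norm_exp[of z] that by (auto intro: order_trans)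
  qed (auto intro!: derivative_eq_intros)
  then show ?thesis by (simp add: mult.commute)
qed

text \<open>From \<open>t <= exp t\<close> at \<open>t = e * \<bar>x\<bar>\<close>. It trades a
  logarithmic factor for an arbitrarily small change of exponent.\<close>

lemma abs_le_exp_abs_divide:
  fixes x :: real
  assumes "0 < e"
  shows "\<bar>x\<bar> \<le> exp (e * \<bar>x\<bar>) / e"
proof -
  have "e * \<bar>x\<bar> \<le> exp (e * \<bar>x\<bar>)" using exp_ge_add_one_self[of "e * \<bar>x\<bar>"] by linarith
  then show ?thesis using assms by (simp add: field_simps)
qed

text \<open>Dominated convergence for the difference quotients. The exponential moment of rate
  \<open>e\<close> dominates the integrand for all \<open>z\<close> in the disc of radius
  \<open>e\<close>, and those quotients for \<open>z\<close> in the disc of radius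
  \<open>e / 2\<close>. The point 0 is enough, since other base points can be absorbed into
  \<open>g\<close>.\<close>

lemma has_field_derivative_integral_exp:
  fixes L :: "'a \<Rightarrow> real" and g :: "'a \<Rightarrow> complex"
  assumes [measurable]: "L \<in> borel_measurable M" "g \<in> borel_measurable M"
    and e: "0 < e"
    and int: "integrable M (\<lambda>x. exp (e * \<bar>L x\<bar>) * norm (g x))"
  shows "((\<lambda>z. \<integral>x. exp (z * of_real (L x)) * g x \<partial>M)
    has_field_derivative (\<integral>x. of_real (L x) * g x \<partial>M)) (at 0)"
proof -
  define F where "F z = (\<integral>x. exp (z * of_real (L x)) * g x \<partial>M)" for z
  have integrable: "integrable M (\<lambda>x. exp (z * of_real (L x)) * g x)" if "norm z \<le> e" for z
  proof (rule Bochner_Integration.integrable_bound[OF int])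
    have "norm (exp (z * of_real (L x))) \<le> exp (e * \<bar>L x\<bar>)" for x
    proof -
      have "norm (exp (z * of_real (L x))) \<le> exp (norm z * \<bar>L x\<bar>)"
        using norm_exp[of "z * of_real (L x)"] by (simp add: norm_mult)
      also have "\<dots> \<le> exp (e * \<bar>L x\<bar>)" using that by (simp add: mult_right_mono)
      finally show ?thesis .
    qed
    then show "AE x in M. norm (exp (z * of_real (L x)) * g x) \<le> norm (exp (e * \<bar>L x\<bar>) * norm (g x))"
      by (simp add: norm_mult mult_right_mono)
  qed simp
  \<comment> \<open>The limit is tested along sequences, the form in which dominated convergence
    applies.\<close>
  have "(\<lambda>i. (F (X i) - F 0) / X i) \<longlonglongrightarrow> (\<integral>x. of_real (L x) * g x \<partial>M)"
    if X: "\<And>i. X i \<noteq> 0" "X \<longlonglongrightarrow> 0" for X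
  proof -
    from X(2) e have "eventually (\<lambda>i. norm (X i) < e / 2) sequentially"
      by (metis half_gt_zero order_tendstoD(2) tendsto_norm_zero)
    then obtain k where k: "\<And>i. k \<le> i \<Longrightarrow> norm (X i) < e / 2"
      by (auto simp: eventually_sequentially)
    \<comment> \<open>Dropping the first \<open>k\<close> terms keeps the parameter within
      \<open>e / 2\<close>.\<close>
    define Y where "Y i = X (i + k)" for i
    have Y: "Y i \<noteq> 0" "norm (Y i) \<le> e / 2" for i
      using X(1) k[of "i + k"] by (auto simp: Y_def)
    have Y0: "filterlim Y (at 0) sequentially"
      unfolding filterlim_at Y_def using X by (auto intro: LIMSEQ_ignore_initial_segment)
    have "(\<lambda>i. \<integral>x. (exp (Y i * of_real (L x)) - 1) / Y i * g x \<partial>M)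
      \<longlonglongrightarrow> (\<integral>x. of_real (L x) * g x \<partial>M)"
    proof (rule integral_dominated_convergence)
      show "integrable M (\<lambda>x. 2 / e * (exp (e * \<bar>L x\<bar>) * norm (g x)))"
        by (rule integrable_mult_right[OF int])
      show "AE x in M. (\<lambda>i. (exp (Y i * of_real (L x)) - 1) / Y i * g x) \<longlonglongrightarrow> of_real (L x) * g x"
      proof (rule AE_I2)
        fix x
        have "((\<lambda>z. exp (z * of_real (L x))) has_field_derivative of_real (L x)) (at (0::complex))"
          by (auto intro!: derivative_eq_intros)
        then have "((\<lambda>z. (exp (z * of_real (L x)) - 1) / z) \<longlongrightarrow> of_real (L x)) (at (0::complex))"
          by (simp add: has_field_derivative_iff)
        from filterlim_compose[OF this Y0]
        show "(\<lambda>i. (exp (Y i * of_real (L x)) - 1) / Y i * g x) \<longlonglongrightarrow> of_real (L x) * g x"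
          by (intro tendsto_mult tendsto_const)
      qed
      show "AE x in M. norm ((exp (Y i * of_real (L x)) - 1) / Y i * g x)
        \<le> 2 / e * (exp (e * \<bar>L x\<bar>) * norm (g x))" for i
      proof (rule AE_I2)
        fix x
        have "norm (exp (Y i * of_real (L x)) - 1) \<le> norm (Y i) * \<bar>L x\<bar> * exp (norm (Y i) * \<bar>L x\<bar>)"
          using norm_exp_minus_one_le[of "Y i * of_real (L x)"] by (simp add: norm_mult)
        then have "norm ((exp (Y i * of_real (L x)) - 1) / Y i) \<le> \<bar>L x\<bar> * exp (norm (Y i) * \<bar>L x\<bar>)"
          using Y(1) by (simp add: norm_divide field_simps)
        \<comment> \<open>Half of the rate \<open>e\<close> pays for the factor
          \<open>\<bar>L x\<bar>\<close>, the other half for the exponential.\<close>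
        also have "\<dots> \<le> (exp (e / 2 * \<bar>L x\<bar>) / (e / 2)) * exp (e / 2 * \<bar>L x\<bar>)"
          using mult_right_mono[OF Y(2)[of i], of "\<bar>L x\<bar>"] e abs_le_exp_abs_divide[of "e / 2" "L x"]
          by (intro mult_mono) auto
        also have "\<dots> = 2 / e * exp (e * \<bar>L x\<bar>)"
          by (simp add: mult_exp_exp)
        finally show "norm ((exp (Y i * of_real (L x)) - 1) / Y i * g x)
          \<le> 2 / e * (exp (e * \<bar>L x\<bar>) * norm (g x))"
          by (simp only: norm_mult mult.assoc[symmetric] mult_right_mono norm_ge_zero)
      qed
    qed simp_all
    also have "(\<lambda>i. \<integral>x. (exp (Y i * of_real (L x)) - 1) / Y i * g x \<partial>M) = (\<lambda>i. (F (Y i) - F 0) / Y i)"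
    proof
      fix i
      have "norm (Y i) \<le> e" using Y(2)[of i] e by linarith
      then have "F (Y i) - F 0 = (\<integral>x. exp (Y i * of_real (L x)) * g x - exp (0 * of_real (L x)) * g x \<partial>M)"
        unfolding F_def using e
        by (intro Bochner_Integration.integral_diff[symmetric] integrable) auto
      also have "\<dots> / Y i = (\<integral>x. (exp (Y i * of_real (L x)) * g x - exp (0 * of_real (L x)) * g x) / Y i \<partial>M)"
        by simp
      also have "\<dots> = (\<integral>x. (exp (Y i * of_real (L x)) - 1) / Y i * g x \<partial>M)"
        by (intro Bochner_Integration.integral_cong) (auto simp: algebra_simps diff_divide_distrib)
      finally show "(\<integral>x. (exp (Y i * of_real (L x)) - 1) / Y i * g x \<partial>M) = (F (Y i) - F 0) / Y i" ..
    qed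
    finally have "(\<lambda>i. (F (X (i + k)) - F 0) / X (i + k)) \<longlonglongrightarrow> (\<integral>x. of_real (L x) * g x \<partial>M)"
      by (simp only: Y_def)
    then show ?thesis by (rule LIMSEQ_offset)
  qed
  then have "(F has_field_derivative (\<integral>x. of_real (L x) * g x \<partial>M)) (at 0)"
    unfolding has_field_derivative_iff tendsto_at_iff_sequentially by (simp add: comp_def)
  then show ?thesis by (simp only: F_def[abs_def])
qed

section \<open>The Dirichlet integral for real exponents\<close>

text \<open>Substituting \<open>t * y\<close> for \<open>y\<close> reduces this to the Beta integral
  on [0,1]. Here \<open>t\<close> stands for the mass left by the other coordinates; the result is
  again a power of \<open>t\<close>, so the next coordinate can be integrated in the same
  way.\<close>

lemma nn_integral_Beta_scaled:
  fixes a b t :: real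
  assumes "0 < a" "0 < b"
  shows "(\<integral>\<^sup>+ y. ennreal (if 0 \<le> y \<and> y \<le> t then y powr (a - 1) * (t - y) powr (b - 1) else 0) \<partial>lborel)
    = ennreal (if 0 \<le> t then Beta a b * t powr (a + b - 1) else 0)"
proof (cases "0 < t")
  case True
  have "(\<integral>\<^sup>+ y. ennreal (if 0 \<le> y \<and> y \<le> t then y powr (a - 1) * (t - y) powr (b - 1) else 0) \<partial>lborel)
    = ennreal t * (\<integral>\<^sup>+ y. ennreal (if 0 \<le> t * y \<and> t * y \<le> t
        then (t * y) powr (a - 1) * (t - t * y) powr (b - 1) else 0) \<partial>lborel)"
    using True
    by (subst nn_integral_real_affine[where c = t and t = 0]) (simp, simp, simp only: add_0 abs_of_pos)
  also have "(\<integral>\<^sup>+ y. ennreal (if 0 \<le> t * y \<and> t * y \<le> t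
        then (t * y) powr (a - 1) * (t - t * y) powr (b - 1) else 0) \<partial>lborel)
    = (\<integral>\<^sup>+ y. ennreal (t powr (a + b - 2)) *
        ennreal (indicator {0..1} y * (y powr (a - 1) * (1 - y) powr (b - 1))) \<partial>lborel)"
  proof (intro nn_integral_cong)
    fix y
    have "(t * y) powr (a - 1) * (t - t * y) powr (b - 1)
        = t powr (a + b - 2) * (y powr (a - 1) * (1 - y) powr (b - 1))" if "0 \<le> y" "y \<le> 1"
    proof -
      have "t - t * y = t * (1 - y)" by (simp add: algebra_simps)
      moreover have "t powr (a + b - 2) = t powr (a - 1) * t powr (b - 1)"
        by (simp flip: powr_add)
      ultimately show ?thesis using True that by (simp add: powr_mult)
    qed
    then show "ennreal (if 0 \<le> t * y \<and> t * y \<le> t then (t * y) powr (a - 1) * (t - t * y) powr (b - 1) else 0)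
      = ennreal (t powr (a + b - 2)) * ennreal (indicator {0..1} y * (y powr (a - 1) * (1 - y) powr (b - 1)))"
      using True by (auto simp: ennreal_mult zero_le_mult_iff indicator_def simp flip: ennreal_mult)
  qed
  also have "\<dots> = ennreal (t powr (a + b - 2)) * ennreal (Beta a b)"
    using nn_integral_has_integral_lebesgue[OF _ has_integral_Beta_real[OF assms]]
    by (subst nn_integral_cmult) auto
  also have "ennreal t * \<dots> = ennreal (Beta a b * t powr (a + b - 1))"
  proof -
    have "t powr (a + b - 1) = t * t powr (a + b - 2)"
      using True by (simp add: powr_mult_base)
    moreover have "0 \<le> Beta a b" using assms by (simp add: Beta_def Gamma_real_pos less_imp_le)
    ultimately show ?thesis using True by (simp add: mult_ac flip: ennreal_mult)
  qed
  finally show ?thesis using True by simp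
next
  case False
  \<comment> \<open>For \<open>t < 0\<close> the range is empty. For \<open>t = 0\<close> only
    \<open>y = 0\<close> remains, where \<open>0 powr c = 0\<close>; the right-hand side vanishes
    for the same reason.\<close>
  then have "(if 0 \<le> y \<and> y \<le> t then y powr (a - 1) * (t - y) powr (b - 1) else 0) = 0" for y
    by auto
  with False show ?thesis by auto
qed

text \<open>Integrating out coordinate \<open>k\<close> merges \<open>a k\<close> into the exponent
  of the remaining mass, turning \<open>b\<close> into \<open>a k + b\<close>. Hence the induction
  is general in \<open>b\<close>. Values in \<open>ennreal\<close> allow iterated integration
  without prior integrability.\<close>

lemma nn_integral_Dirichlet:
  fixes a :: "'i \<Rightarrow> real" and b :: real
  assumes "finite I" "\<And>i. i \<in> I \<Longrightarrow> 0 < a i" "0 < b"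
  shows "(\<integral>\<^sup>+ x. ennreal (if (\<forall>i\<in>I. 0 \<le> x i) \<and> (\<Sum>i\<in>I. x i) \<le> 1
        then (\<Prod>i\<in>I. x i powr (a i - 1)) * (1 - (\<Sum>i\<in>I. x i)) powr (b - 1) else 0)
      \<partial>Pi\<^sub>M I (\<lambda>_. lborel))
    = ennreal ((\<Prod>i\<in>I. Gamma (a i)) * Gamma b / Gamma ((\<Sum>i\<in>I. a i) + b))"
  using assms
proof (induction I arbitrary: b rule: finite_induct)
  case empty
  \<comment> \<open>With no coordinates the measure is a unit point mass and the claim reads 1 =
    \<open>Gamma b / Gamma b\<close>.\<close>
  then have "Gamma b \<noteq> 0" by (metis Gamma_real_pos less_irrefl)
  then show ?case
    by (simp add: PiM_empty nn_integral_count_space_finite)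
next
  case (insert k I)
  interpret product_sigma_finite "\<lambda>_::'i. lborel :: real measure"
    by standard
  note [simp] = insert.hyps
  have a: "0 < a k" "\<And>i. i \<in> I \<Longrightarrow> 0 < a i" using insert.prems by auto
  have "(\<integral>\<^sup>+ x. ennreal (if (\<forall>i\<in>insert k I. 0 \<le> x i) \<and> (\<Sum>i\<in>insert k I. x i) \<le> 1
        then (\<Prod>i\<in>insert k I. x i powr (a i - 1)) * (1 - (\<Sum>i\<in>insert k I. x i)) powr (b - 1) else 0)
      \<partial>Pi\<^sub>M (insert k I) (\<lambda>_. lborel))
    = (\<integral>\<^sup>+ x. (\<integral>\<^sup>+ y. ennreal (if (\<forall>i\<in>insert k I. 0 \<le> (x(k := y)) i) \<and> (\<Sum>i\<in>insert k I. (x(k := y)) i) \<le> 1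
        then (\<Prod>i\<in>insert k I. (x(k := y)) i powr (a i - 1))
          * (1 - (\<Sum>i\<in>insert k I. (x(k := y)) i)) powr (b - 1) else 0) \<partial>lborel) \<partial>Pi\<^sub>M I (\<lambda>_. lborel))"
    by (subst product_nn_integral_insert) simp_all
  also have "\<dots> = (\<integral>\<^sup>+ x. ennreal (Beta (a k) b) * ennreal (if (\<forall>i\<in>I. 0 \<le> x i) \<and> (\<Sum>i\<in>I. x i) \<le> 1
        then (\<Prod>i\<in>I. x i powr (a i - 1)) * (1 - (\<Sum>i\<in>I. x i)) powr (a k + b - 1) else 0)
      \<partial>Pi\<^sub>M I (\<lambda>_. lborel))"
  proof (intro nn_integral_cong)
    fix x :: "'i \<Rightarrow> real"
    \<comment> \<open>\<open>P\<close> is the factor independent of \<open>y\<close>, and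
      \<open>t\<close> bounds \<open>y\<close>. The condition that the sum be at most 1 is kept out
      of \<open>P\<close>: it reappears as \<open>0 <= t\<close>.\<close>
    define P where "P = (if \<forall>i\<in>I. 0 \<le> x i then \<Prod>i\<in>I. x i powr (a i - 1) else 0)"
    define t where "t = 1 - (\<Sum>i\<in>I. x i)"
    have P: "0 \<le> P" by (auto simp: P_def intro!: prod_nonneg)
    have upd: "(\<Sum>i\<in>I. (x(k := y)) i) = (\<Sum>i\<in>I. x i)"
      "(\<Prod>i\<in>I. (x(k := y)) i powr (a i - 1)) = (\<Prod>i\<in>I. x i powr (a i - 1))"
      "(\<forall>i\<in>I. 0 \<le> (x(k := y)) i) \<longleftrightarrow> (\<forall>i\<in>I. 0 \<le> x i)" for y
      by (auto intro!: sum.cong prod.cong ball_cong)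
    have "(\<integral>\<^sup>+ y. ennreal (if (\<forall>i\<in>insert k I. 0 \<le> (x(k := y)) i) \<and> (\<Sum>i\<in>insert k I. (x(k := y)) i) \<le> 1
        then (\<Prod>i\<in>insert k I. (x(k := y)) i powr (a i - 1))
          * (1 - (\<Sum>i\<in>insert k I. (x(k := y)) i)) powr (b - 1) else 0) \<partial>lborel)
      = (\<integral>\<^sup>+ y. ennreal P * ennreal (if 0 \<le> y \<and> y \<le> t then y powr (a k - 1) * (t - y) powr (b - 1) else 0) \<partial>lborel)"
    proof (intro nn_integral_cong)
      fix y
      have *: "y + (\<Sum>i\<in>I. x i) \<le> 1 \<longleftrightarrow> y \<le> t" "1 - (y + (\<Sum>i\<in>I. x i)) = t - y"
        by (auto simp: t_def)
      have "(if (\<forall>i\<in>insert k I. 0 \<le> (x(k := y)) i) \<and> (\<Sum>i\<in>insert k I. (x(k := y)) i) \<le> 1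
        then (\<Prod>i\<in>insert k I. (x(k := y)) i powr (a i - 1))
          * (1 - (\<Sum>i\<in>insert k I. (x(k := y)) i)) powr (b - 1) else 0)
        = P * (if 0 \<le> y \<and> y \<le> t then y powr (a k - 1) * (t - y) powr (b - 1) else 0)"
        unfolding ball_simps sum.insert[OF insert.hyps] prod.insert[OF insert.hyps] upd fun_upd_same *
        by (auto simp: P_def)
      then show "ennreal (if (\<forall>i\<in>insert k I. 0 \<le> (x(k := y)) i) \<and> (\<Sum>i\<in>insert k I. (x(k := y)) i) \<le> 1
        then (\<Prod>i\<in>insert k I. (x(k := y)) i powr (a i - 1))
          * (1 - (\<Sum>i\<in>insert k I. (x(k := y)) i)) powr (b - 1) else 0)
        = ennreal P * ennreal (if 0 \<le> y \<and> y \<le> t then y powr (a k - 1) * (t - y) powr (b - 1) else 0)"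
        using P by (simp add: ennreal_mult')
    qed
    also have "\<dots> = ennreal P * ennreal (if 0 \<le> t then Beta (a k) b * t powr (a k + b - 1) else 0)"
      using nn_integral_Beta_scaled[OF a(1) \<open>0 < b\<close>, of t] by (subst nn_integral_cmult) auto
    also have "\<dots> = ennreal (Beta (a k) b) * ennreal (if (\<forall>i\<in>I. 0 \<le> x i) \<and> (\<Sum>i\<in>I. x i) \<le> 1
        then (\<Prod>i\<in>I. x i powr (a i - 1)) * (1 - (\<Sum>i\<in>I. x i)) powr (a k + b - 1) else 0)"
    proof -
      have "0 \<le> Beta (a k) b"
        using a(1) \<open>0 < b\<close> by (simp add: Beta_def Gamma_real_pos less_imp_le)
      moreover have "P * (if 0 \<le> t then Beta (a k) b * t powr (a k + b - 1) else 0) =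
        Beta (a k) b * (if (\<forall>i\<in>I. 0 \<le> x i) \<and> (\<Sum>i\<in>I. x i) \<le> 1
        then (\<Prod>i\<in>I. x i powr (a i - 1)) * (1 - (\<Sum>i\<in>I. x i)) powr (a k + b - 1) else 0)"
        by (auto simp: P_def t_def)
      ultimately show ?thesis using P by (simp only: flip: ennreal_mult')
    qed
    finally show "(\<integral>\<^sup>+ y. ennreal (if (\<forall>i\<in>insert k I. 0 \<le> (x(k := y)) i) \<and> (\<Sum>i\<in>insert k I. (x(k := y)) i) \<le> 1
        then (\<Prod>i\<in>insert k I. (x(k := y)) i powr (a i - 1))
          * (1 - (\<Sum>i\<in>insert k I. (x(k := y)) i)) powr (b - 1) else 0) \<partial>lborel)
      = ennreal (Beta (a k) b) * ennreal (if (\<forall>i\<in>I. 0 \<le> x i) \<and> (\<Sum>i\<in>I. x i) \<le> 1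
        then (\<Prod>i\<in>I. x i powr (a i - 1)) * (1 - (\<Sum>i\<in>I. x i)) powr (a k + b - 1) else 0)" .
  qed
  also have "\<dots> = ennreal (Beta (a k) b) *
      ennreal ((\<Prod>i\<in>I. Gamma (a i)) * Gamma (a k + b) / Gamma ((\<Sum>i\<in>I. a i) + (a k + b)))"
    using a \<open>0 < b\<close> by (subst nn_integral_cmult) (simp_all add: insert.IH)
  also have "\<dots> = ennreal ((\<Prod>i\<in>insert k I. Gamma (a i)) * Gamma b / Gamma ((\<Sum>i\<in>insert k I. a i) + b))"
  proof -
    \<comment> \<open>The positive factor \<open>Gamma (a k + b)\<close> of the induction hypothesis
      cancels against the denominator of \<open>Beta (a k) b\<close>.\<close>
    have "0 < Gamma (a k + b)" "0 \<le> Beta (a k) b"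
      using a(1) \<open>0 < b\<close> by (simp_all add: Beta_def Gamma_real_pos less_imp_le)
    then show ?thesis
      by (simp add: Beta_def add_ac mult_ac flip: ennreal_mult')
  qed
  finally show ?case .
qed

section \<open>The integrand on the simplex and shifts of its exponents\<close>

text \<open>Outside the simplex the base may be negative, where the principal logarithm is
  \<open>ln \<bar>x\<bar>\<close> plus \<open>pi * \<i>\<close>, so the power is written piecewise
  through the real logarithm.\<close>

lemma borel_measurable_of_real_powr [measurable]:
  "(\<lambda>x. of_real x powr c :: complex) \<in> borel_measurable borel"
proof -
  have "(\<lambda>x. of_real x powr c) = (\<lambda>x::real. if x = 0 then 0
      else exp (c * (of_real (ln \<bar>x\<bar>) + (if x < 0 then pi else 0) * \<i>)))"
    by (auto simp: fun_eq_iff powr_def Ln_of_real')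
  also have "\<dots> \<in> borel_measurable borel" by measurable
  finally show ?thesis .
qed

definition simplex_region :: "nat \<Rightarrow> (nat \<Rightarrow> real) set" where
  "simplex_region m = {x. (\<forall>i\<in>{1..<m}. 0 \<le> x i) \<and> (\<Sum>i\<in>{1..<m}. x i) \<le> 1}"

definition simplex_weight :: "nat \<Rightarrow> (nat \<Rightarrow> complex) \<Rightarrow> (nat \<Rightarrow> real) \<Rightarrow> complex" where
  "simplex_weight m n x = (\<Prod>i\<in>{1..m}. of_real (simplex_point m x i) powr n i)"

abbreviation simplex_measure :: "nat \<Rightarrow> (nat \<Rightarrow> real) measure" where
  "simplex_measure m \<equiv> Pi\<^sub>M {1..<m} (\<lambda>_. lborel)"

text \<open>The indicator is a complex factor, so that the set integral becomes an integral over the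
  whole space and norms split into products.\<close>

definition simplex_integrand ::
  "nat \<Rightarrow> ((nat \<Rightarrow> real) \<Rightarrow> complex) \<Rightarrow> (nat \<Rightarrow> complex) \<Rightarrow> (nat \<Rightarrow> real) \<Rightarrow> complex" where
  "simplex_integrand m F n x =
     indicator (simplex_region m) x * (F (simplex_point m x) * simplex_weight m n x)"

lemma simplex_integral_eq:
  "simplex_integral m F n = integral\<^sup>L (simplex_measure m) (simplex_integrand m F n)"
proof -
  have "indicator A x *\<^sub>R (y :: complex) = indicator A x * y" for A :: "(nat \<Rightarrow> real) set" and x y
    by (simp add: indicator_def)
  then show ?thesis
    unfolding simplex_integral_def set_lebesgue_integral_def simplex_integrand_def
      simplex_region_def simplex_weight_def by simp
qed

lemma simplex_point_range:
  assumes "x \<in> simplex_region m" "i \<in> {1..m}"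
  shows "0 \<le> simplex_point m x i" "simplex_point m x i \<le> 1"
proof -
  show "0 \<le> simplex_point m x i"
    using assms by (auto simp: simplex_point_def simplex_region_def)
  have nonneg: "0 \<le> (\<Sum>i\<in>{1..<m}. x i)"
    using assms by (intro sum_nonneg) (auto simp: simplex_region_def)
  have "x i \<le> (\<Sum>i\<in>{1..<m}. x i)" if "i \<noteq> m"
    using assms that by (intro member_le_sum) (auto simp: simplex_region_def)
  then show "simplex_point m x i \<le> 1"
    using assms nonneg by (fastforce simp: simplex_point_def simplex_region_def)
qed

lemma measurable_simplex_point [measurable]:
  assumes "i \<in> {1..m}"
  shows "(\<lambda>x. simplex_point m x i) \<in> borel_measurable (simplex_measure m)"
proof (cases "i = m")
  case True
  have "(\<lambda>x. 1 - (\<Sum>i\<in>{1..<m}. x i)) \<in> borel_measurable (simplex_measure m)" by measurable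
  with True show ?thesis by (simp add: simplex_point_def)
next
  case False
  then have "i \<in> {1..<m}" using assms by auto
  then have "(\<lambda>x. x i) \<in> borel_measurable (simplex_measure m)" by measurable
  with False show ?thesis by (simp add: simplex_point_def)
qed

lemma measurable_simplex_integrand:
  assumes "(\<lambda>x. F (simplex_point m x)) \<in> borel_measurable (simplex_measure m)"
  shows "simplex_integrand m F n \<in> borel_measurable (simplex_measure m)"
proof -
  note [measurable] = assms
  have [measurable]: "(indicator (simplex_region m) :: _ \<Rightarrow> complex) \<in> borel_measurable (simplex_measure m)"
    unfolding indicator_def simplex_region_def mem_Collect_eq by measurable
  have [measurable]: "simplex_weight m n \<in> borel_measurable (simplex_measure m)"
    unfolding simplex_weight_def[abs_def] by measurable
  show ?thesis unfolding simplex_integrand_def[abs_def] by measurable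
qed

text \<open>Also true where \<open>p k = 0\<close>: both sides vanish, since \<open>0 powr c = 0\<close>.\<close>

lemma simplex_weight_shift:
  assumes x: "x \<in> simplex_region m" and k: "k \<in> {1..m}"
  shows "simplex_weight m (n(k := n k + z)) x =
    exp (z * of_real (ln (simplex_point m x k))) * simplex_weight m n x"
proof -
  define p where "p = simplex_point m x"
  have "of_real (p k) powr (n k + z) = exp (z * of_real (ln (p k))) * of_real (p k) powr n k"
    using simplex_point_range(1)[OF x k]
    by (cases "p k = 0") (simp_all add: p_def powr_def Ln_of_real ring_distribs exp_add)
  moreover have "(\<Prod>i\<in>{1..m}-{k}. of_real (p i) powr (n(k := n k + z)) i) =
      (\<Prod>i\<in>{1..m}-{k}. of_real (p i) powr n i :: complex)"
    by (intro prod.cong) auto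
  ultimately show ?thesis
    unfolding simplex_weight_def p_def[symmetric]
    using prod.remove[OF _ k, of "\<lambda>i. of_real (p i) powr (n(k := n k + z)) i :: complex"]
      prod.remove[OF _ k, of "\<lambda>i. of_real (p i) powr n i :: complex"]
    by simp
qed

text \<open>Puts the dependence on one exponent into the form \<open>exp (z * L)\<close> needed for
  differentiation, with \<open>L\<close> the logarithm of a coordinate. Off the region both sides
  are 0.\<close>

lemma simplex_integrand_shift:
  assumes "k \<in> {1..m}"
  shows "simplex_integrand m F (n(k := n k + z)) x =
    exp (z * of_real (ln (simplex_point m x k))) * simplex_integrand m F n x"
  by (cases "x \<in> simplex_region m")
     (simp_all add: simplex_integrand_def simplex_weight_shift[OF _ assms])

text \<open>Coordinates are at most 1 on the simplex, so \<open>- ln\<close> is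
  \<open>\<bar>ln\<bar>\<close> there. Integrability with a lowered exponent thus is the exponential
  moment condition on the logarithm.\<close>

lemma norm_simplex_integrand_shift:
  assumes "k \<in> {1..m}"
  shows "norm (simplex_integrand m F (n(k := n k - of_real d)) x) =
    exp (d * \<bar>ln (simplex_point m x k)\<bar>) * norm (simplex_integrand m F n x)"
proof (cases "x \<in> simplex_region m")
  case True
  have "ln (simplex_point m x k) \<le> 0"
    using simplex_point_range[OF True assms] by (cases "simplex_point m x k = 0") auto
  then show ?thesis
    using simplex_integrand_shift[OF assms, of F n "- of_real d" x]
    by (simp add: norm_mult)
qed (simp add: simplex_integrand_def)

section \<open>Logarithmic factors as derivatives in an exponent\<close>

text \<open>A factor \<open>\<bar>ln (p k)\<bar>\<close> is at most \<open>1 / d\<close> times the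
  factor produced by lowering exponent \<open>k\<close> by \<open>d\<close>.\<close>

lemma integrable_simplex_integrand_ln:
  assumes k: "k \<in> {1..m}" and d: "0 < d"
    and F: "(\<lambda>x. F (simplex_point m x)) \<in> borel_measurable (simplex_measure m)"
    and int: "integrable (simplex_measure m) (simplex_integrand m F (n(k := n k - of_real d)))"
  shows "integrable (simplex_measure m) (simplex_integrand m (\<lambda>p. of_real (ln (p k)) * F p) n)"
proof (rule Bochner_Integration.integrable_bound)
  show "integrable (simplex_measure m)
    (\<lambda>x. 1 / d * norm (simplex_integrand m F (n(k := n k - of_real d)) x))"
    using int by (intro integrable_mult_right integrable_norm)
  note [measurable] = F measurable_simplex_point[OF k]
  show "simplex_integrand m (\<lambda>p. of_real (ln (p k)) * F p) n \<in> borel_measurable (simplex_measure m)"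
    by (rule measurable_simplex_integrand) measurable
  have "norm (simplex_integrand m (\<lambda>p. of_real (ln (p k)) * F p) n x)
      \<le> 1 / d * norm (simplex_integrand m F (n(k := n k - of_real d)) x)" for x
  proof -
    have "norm (simplex_integrand m (\<lambda>p. of_real (ln (p k)) * F p) n x) =
        \<bar>ln (simplex_point m x k)\<bar> * norm (simplex_integrand m F n x)"
      by (simp add: simplex_integrand_def norm_mult)
    also have "\<dots> \<le> exp (d * \<bar>ln (simplex_point m x k)\<bar>) / d * norm (simplex_integrand m F n x)"
      by (intro mult_right_mono abs_le_exp_abs_divide d) simp
    also have "\<dots> = 1 / d * norm (simplex_integrand m F (n(k := n k - of_real d)) x)"
      by (simp add: norm_simplex_integrand_shift[OF k])
    finally show ?thesis .
  qed
  then show "AE x in simplex_measure m. norm (simplex_integrand m (\<lambda>p. of_real (ln (p k)) * F p) n x)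
      \<le> norm (1 / d * norm (simplex_integrand m F (n(k := n k - of_real d)) x))"
    using d by simp
qed

lemma has_field_derivative_simplex_integral:
  assumes k: "k \<in> {1..m}" and d: "0 < d"
    and F: "(\<lambda>x. F (simplex_point m x)) \<in> borel_measurable (simplex_measure m)"
    and int: "integrable (simplex_measure m) (simplex_integrand m F (n(k := n k - of_real d)))"
  shows "((\<lambda>z. simplex_integral m F (n(k := n k + z)))
    has_field_derivative simplex_integral m (\<lambda>p. of_real (ln (p k)) * F p) n) (at 0)"
proof -
  have "simplex_integral m F (n(k := n k + z)) =
      (\<integral>x. exp (z * of_real (ln (simplex_point m x k))) * simplex_integrand m F n x \<partial>simplex_measure m)" for z
    unfolding simplex_integral_eq using simplex_integrand_shift[OF k]
    by (intro Bochner_Integration.integral_cong) auto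
  moreover have "simplex_integral m (\<lambda>p. of_real (ln (p k)) * F p) n =
      (\<integral>x. of_real (ln (simplex_point m x k)) * simplex_integrand m F n x \<partial>simplex_measure m)"
    unfolding simplex_integral_eq
    by (intro Bochner_Integration.integral_cong) (auto simp: simplex_integrand_def)
  moreover note [measurable] = measurable_simplex_point[OF k] measurable_simplex_integrand[OF F]
  ultimately show ?thesis
    using has_field_derivative_integral_exp[of "\<lambda>x. ln (simplex_point m x k)" "simplex_measure m"
        "simplex_integrand m F n" d]
      integrable_norm[OF int] d
    by (simp add: norm_simplex_integrand_shift[OF k])
qed

section \<open>The normalization integral for real exponents\<close>

text \<open>The multivariate Beta function at the points \<open>n i + 1\<close>. The
  \<open>+ 1\<close> lies inside the sum, so the denominator is Gamma at N + m.\<close>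

definition dirichlet_constant :: "nat \<Rightarrow> (nat \<Rightarrow> complex) \<Rightarrow> complex" where
  "dirichlet_constant m n = (\<Prod>i\<in>{1..m}. Gamma (n i + 1)) / Gamma (\<Sum>i\<in>{1..m}. n i + 1)"

text \<open>The norm of a power of a nonnegative base depends only on the real part of the exponent.
  The eliminated coordinate \<open>m\<close> plays the part of \<open>b\<close> in the Dirichlet
  integral.\<close>

lemma nn_integral_norm_simplex_integrand:
  assumes m: "m \<ge> 1" and n: "\<And>i. i \<in> {1..m} \<Longrightarrow> Re (n i) > -1"
  shows "(\<integral>\<^sup>+ x. ennreal (norm (simplex_integrand m (\<lambda>_. 1) n x)) \<partial>simplex_measure m) =
    ennreal ((\<Prod>i\<in>{1..m}. Gamma (Re (n i) + 1)) / Gamma (\<Sum>i\<in>{1..m}. Re (n i) + 1))"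
proof -
  have split: "{1..m} = insert m {1..<m}" using m by auto
  have "norm (simplex_integrand m (\<lambda>_. 1) n x) =
    (if (\<forall>i\<in>{1..<m}. 0 \<le> x i) \<and> (\<Sum>i\<in>{1..<m}. x i) \<le> 1
     then (\<Prod>i\<in>{1..<m}. x i powr (Re (n i) + 1 - 1))
       * (1 - (\<Sum>i\<in>{1..<m}. x i)) powr (Re (n m) + 1 - 1) else 0)" for x
  proof (cases "x \<in> simplex_region m")
    case True
    have "norm (simplex_integrand m (\<lambda>_. 1) n x) = (\<Prod>i\<in>{1..m}. simplex_point m x i powr Re (n i))"
      using True simplex_point_range(1)[OF True]
      by (auto simp: simplex_integrand_def simplex_weight_def norm_powr_real_powr norm_mult
          simp flip: prod_norm intro!: prod.cong)
    also have "\<dots> = (\<Prod>i\<in>{1..<m}. simplex_point m x i powr Re (n i)) * simplex_point m x m powr Re (n m)"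
      unfolding split by simp
    also have "(\<Prod>i\<in>{1..<m}. simplex_point m x i powr Re (n i)) = (\<Prod>i\<in>{1..<m}. x i powr Re (n i))"
      by (intro prod.cong) (auto simp: simplex_point_def)
    finally show ?thesis using True by (simp add: simplex_region_def simplex_point_def)
  next
    case False
    then show ?thesis unfolding simplex_integrand_def by (auto simp: simplex_region_def)
  qed
  moreover have "0 < Re (n i) + 1" if "i \<in> {1..m}" for i using n[OF that] by linarith
  moreover have "(\<Prod>i\<in>{1..m}. Gamma (Re (n i) + 1)) =
      (\<Prod>i\<in>{1..<m}. Gamma (Re (n i) + 1)) * Gamma (Re (n m) + 1)"
    "(\<Sum>i\<in>{1..m}. Re (n i) + 1) = (\<Sum>i\<in>{1..<m}. Re (n i) + 1) + (Re (n m) + 1)"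
    unfolding split by simp_all
  ultimately show ?thesis
    using nn_integral_Dirichlet[of "{1..<m}" "\<lambda>i. Re (n i) + 1" "Re (n m) + 1"] m
    by simp
qed

lemma integrable_simplex_integrand_1:
  assumes "m \<ge> 1" "\<And>i. i \<in> {1..m} \<Longrightarrow> Re (n i) > -1"
  shows "integrable (simplex_measure m) (simplex_integrand m (\<lambda>_. 1) n)"
  using nn_integral_norm_simplex_integrand[OF assms]
  by (intro integrableI_bounded measurable_simplex_integrand) auto

text \<open>With real exponents the integrand is nonnegative and equals its norm, whose integral is
  known.\<close>

lemma simplex_integral_1_real:
  assumes m: "m \<ge> 1" and n: "\<And>i. i \<in> {1..m} \<Longrightarrow> Re (n i) > -1"
    and real: "\<And>i. i \<in> {1..m} \<Longrightarrow> n i \<in> \<real>"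
  shows "simplex_integral m (\<lambda>_. 1) n = dirichlet_constant m n"
proof -
  define D where "D = (\<Prod>i\<in>{1..m}. Gamma (Re (n i) + 1)) / Gamma (\<Sum>i\<in>{1..m}. Re (n i) + 1)"
  have pos: "0 < Re (n i) + 1" if "i \<in> {1..m}" for i using n[OF that] by linarith
  have nonneg: "simplex_integrand m (\<lambda>_. 1) n x = of_real (norm (simplex_integrand m (\<lambda>_. 1) n x))" for x
  proof (cases "x \<in> simplex_region m")
    case True
    have "of_real (simplex_point m x i) powr n i = of_real (norm (of_real (simplex_point m x i) powr n i))"
      if "i \<in> {1..m}" for i
      using simplex_point_range(1)[OF True that] real[OF that]
      by (simp add: norm_powr_real_powr powr_Reals_eq)
    then have "simplex_weight m n x = of_real (norm (simplex_weight m n x))"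
      unfolding simplex_weight_def prod_norm[symmetric] of_real_prod by (intro prod.cong) auto
    then show ?thesis using True by (simp add: simplex_integrand_def norm_mult)
  qed (simp add: simplex_integrand_def)
  have "simplex_integral m (\<lambda>_. 1) n =
      (\<integral>x. of_real (norm (simplex_integrand m (\<lambda>_. 1) n x)) \<partial>simplex_measure m)"
    unfolding simplex_integral_eq by (intro Bochner_Integration.integral_cong refl nonneg)
  also have "\<dots> = of_real (\<integral>x. norm (simplex_integrand m (\<lambda>_. 1) n x) \<partial>simplex_measure m)"
    by (rule integral_complex_of_real)
  also have "(\<integral>x. norm (simplex_integrand m (\<lambda>_. 1) n x) \<partial>simplex_measure m) = D"
  proof -
    have "0 < Gamma (\<Sum>i\<in>{1..m}. Re (n i) + 1)"
      using pos m by (intro Gamma_real_pos sum_pos) auto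
    then have "0 \<le> D" unfolding D_def using pos
      by (intro divide_nonneg_pos prod_nonneg) (auto simp: Gamma_real_pos less_imp_le)
    then show ?thesis
      using nn_integral_norm_simplex_integrand[OF m n]
        borel_measurable_integrable[OF integrable_simplex_integrand_1[OF m n]]
      by (subst integral_eq_nn_integral) (auto simp: D_def)
  qed
  also have "of_real D = dirichlet_constant m n"
  proof -
    have "of_real (Re (n i)) = n i" if "i \<in> {1..m}" for i using real[OF that] by simp
    then have "(\<Prod>i\<in>{1..m}. Gamma (of_real (Re (n i)) + 1)) = (\<Prod>i\<in>{1..m}. Gamma (n i + 1))"
      "(\<Sum>i\<in>{1..m}. of_real (Re (n i)) + 1) = (\<Sum>i\<in>{1..m}. n i + 1)"
      by (auto intro!: prod.cong sum.cong)
    then show ?thesis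
      unfolding D_def dirichlet_constant_def by (simp flip: Gamma_complex_of_real)
  qed
  finally show ?thesis .
qed

section \<open>Functional equation and derivative of the Gamma quotient\<close>

lemma not_nonpos_Ints_if_Re_pos: "0 < Re z \<Longrightarrow> z \<notin> \<int>\<^sub>\<le>\<^sub>0"
  by (auto elim!: nonpos_Ints_cases)

lemma not_nonpos_Reals_if_Re_pos: "0 < Re z \<Longrightarrow> z \<notin> \<real>\<^sub>\<le>\<^sub>0"
  by (auto simp: complex_nonpos_Reals_iff)

lemma Re_sum_plus_one_pos:
  fixes m :: nat
  assumes "m \<ge> 1" and "\<And>i. i \<in> {1..m} \<Longrightarrow> Re (n i) > -1"
  shows "0 < Re (\<Sum>i\<in>{1..m}. n i + 1)"
  unfolding Re_sum
proof (rule sum_pos)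
  show "0 < Re (n i + 1)" if "i \<in> {1..m}" for i
    using assms(2)[OF that] by simp
qed (use assms(1) in auto)

lemma sum_plus_one_shift:
  fixes n :: "nat \<Rightarrow> complex"
  assumes "k \<in> {1..m}"
  shows "(\<Sum>i\<in>{1..m}. (n(k := n k + z)) i + 1) = (\<Sum>i\<in>{1..m}. n i + 1) + z"
proof -
  have "(\<Sum>i\<in>{1..m}-{k}. (n(k := n k + z)) i + 1) = (\<Sum>i\<in>{1..m}-{k}. n i + 1)"
    by (intro sum.cong) auto
  then show ?thesis
    using sum.remove[OF _ assms, of "\<lambda>i. (n(k := n k + z)) i + 1"]
      sum.remove[OF _ assms, of "\<lambda>i. n i + 1"] by simp
qed

lemma dirichlet_constant_shift:
  assumes "k \<in> {1..m}"
  shows "dirichlet_constant m (n(k := n k + z)) =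
    Gamma (n k + z + 1) * (\<Prod>i\<in>{1..m}-{k}. Gamma (n i + 1)) / Gamma ((\<Sum>i\<in>{1..m}. n i + 1) + z)"
proof -
  have "(\<Prod>i\<in>{1..m}-{k}. Gamma ((n(k := n k + z)) i + 1)) = (\<Prod>i\<in>{1..m}-{k}. Gamma (n i + 1))"
    by (intro prod.cong) auto
  then show ?thesis
    unfolding dirichlet_constant_def sum_plus_one_shift[OF assms]
    using prod.remove[OF _ assms, of "\<lambda>i. Gamma ((n(k := n k + z)) i + 1)"] by simp
qed

lemma dirichlet_constant_nonzero:
  assumes "m \<ge> 1" and n: "\<And>i. i \<in> {1..m} \<Longrightarrow> Re (n i) > -1"
  shows "dirichlet_constant m n \<noteq> 0"
proof -
  have "Gamma (n i + 1) \<noteq> 0" if "i \<in> {1..m}" for i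
    using n[OF that] by (intro Gamma_nonzero not_nonpos_Ints_if_Re_pos) simp
  moreover have "Gamma (\<Sum>i\<in>{1..m}. n i + 1) \<noteq> 0"
    by (intro Gamma_nonzero not_nonpos_Ints_if_Re_pos Re_sum_plus_one_pos assms)
  ultimately show ?thesis by (simp add: dirichlet_constant_def)
qed

text \<open>The functional equation of Gamma, used once in the numerator and once in the
  denominator. This is the source of the rational prefactors.\<close>

lemma dirichlet_constant_plus_one:
  assumes "m \<ge> 1" and n: "\<And>i. i \<in> {1..m} \<Longrightarrow> Re (n i) > -1" and k: "k \<in> {1..m}"
  shows "dirichlet_constant m (n(k := n k + 1)) =
    (n k + 1) / (\<Sum>i\<in>{1..m}. n i + 1) * dirichlet_constant m n"
proof -
  have "Gamma (n k + 1 + 1) = (n k + 1) * Gamma (n k + 1)"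
    using n[OF k] by (intro Gamma_plus1 not_nonpos_Ints_if_Re_pos) simp
  moreover have "Gamma ((\<Sum>i\<in>{1..m}. n i + 1) + 1) =
      (\<Sum>i\<in>{1..m}. n i + 1) * Gamma (\<Sum>i\<in>{1..m}. n i + 1)"
    by (intro Gamma_plus1 not_nonpos_Ints_if_Re_pos Re_sum_plus_one_pos assms)
  ultimately show ?thesis
    \<comment> \<open>The instance with shift 0 writes the original constant with the same factor
      \<open>k\<close> split off.\<close>
    using dirichlet_constant_shift[OF k, of n 1] dirichlet_constant_shift[OF k, of n 0] by simp
qed

text \<open>Logarithmic differentiation: the exponent occurs in one Gamma factor above and in the
  total below, and each contributes a Digamma.\<close>

lemma has_field_derivative_dirichlet_constant:
  assumes "m \<ge> 1" and n: "\<And>i. i \<in> {1..m} \<Longrightarrow> Re (n i) > -1" and k: "k \<in> {1..m}"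
  shows "((\<lambda>z. dirichlet_constant m (n(k := n k + z))) has_field_derivative
    dirichlet_constant m n * (Digamma (n k + 1) - Digamma (\<Sum>i\<in>{1..m}. n i + 1))) (at 0)"
proof -
  define A where "A = (\<Sum>i\<in>{1..m}. n i + 1)"
  define P where "P = (\<Prod>i\<in>{1..m}-{k}. Gamma (n i + 1))"
  have A: "A \<notin> \<int>\<^sub>\<le>\<^sub>0"
    unfolding A_def by (intro not_nonpos_Ints_if_Re_pos Re_sum_plus_one_pos assms)
  have nk: "n k + 1 \<notin> \<int>\<^sub>\<le>\<^sub>0"
    using n[OF k] by (intro not_nonpos_Ints_if_Re_pos) simp
  have "((\<lambda>z. Gamma (n k + z + 1) * P / Gamma (A + z)) has_field_derivative
    Gamma (n k + 1) * P / Gamma A * (Digamma (n k + 1) - Digamma A)) (at 0)"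
    using A nk
    by (auto intro!: derivative_eq_intros simp: Gamma_eq_zero_iff field_simps)
  then show ?thesis
    using dirichlet_constant_shift[OF k, of n 0]
    by (simp add: dirichlet_constant_shift[OF k] A_def P_def)
qed

section \<open>Analytic continuation to complex exponents\<close>

lemma measurable_simplex_ln [measurable]:
  "k \<in> {1..m} \<Longrightarrow> (\<lambda>x. of_real (ln (simplex_point m x k)) :: complex) \<in> borel_measurable (simplex_measure m)"
  by measurable

lemma integrable_simplex_integrand_1_lower:
  assumes m: "m \<ge> 1" and n: "\<And>i. i \<in> {1..m} \<Longrightarrow> Re (n i) > -1" and k: "k \<in> {1..m}"
  obtains d where "0 < d" "\<And>i. i \<in> {1..m} \<Longrightarrow> Re ((n(k := n k - of_real d)) i) > -1"
    "integrable (simplex_measure m) (simplex_integrand m (\<lambda>_. 1) (n(k := n k - of_real d)))"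
proof
  \<comment> \<open>Half the distance from \<open>Re (n k)\<close> to the boundary value -1.\<close>
  define d where "d = (Re (n k) + 1) / 2"
  show "0 < d" using n[OF k] by (simp add: d_def)
  show *: "Re ((n(k := n k - of_real d)) i) > -1" if "i \<in> {1..m}" for i
    using n[OF that] by (auto simp: d_def field_simps)
  show "integrable (simplex_measure m) (simplex_integrand m (\<lambda>_. 1) (n(k := n k - of_real d)))"
    by (rule integrable_simplex_integrand_1[OF m *])
qed

lemma has_field_derivative_simplex_integral_1:
  assumes m: "m \<ge> 1" and n: "\<And>i. i \<in> {1..m} \<Longrightarrow> Re (n i) > -1" and k: "k \<in> {1..m}"
  shows "((\<lambda>z. simplex_integral m (\<lambda>_. 1) (n(k := n k + z))) has_field_derivative
    simplex_integral m (\<lambda>p. of_real (ln (p k))) n) (at 0)"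
proof -
  obtain d where "0 < d"
    "integrable (simplex_measure m) (simplex_integrand m (\<lambda>_. 1) (n(k := n k - of_real d)))"
    using integrable_simplex_integrand_1_lower[where n = n, OF assms] by blast
  from has_field_derivative_simplex_integral[OF k this(1) _ this(2)] show ?thesis by simp
qed

lemma integrable_simplex_integrand_ln_1:
  assumes m: "m \<ge> 1" and n: "\<And>i. i \<in> {1..m} \<Longrightarrow> Re (n i) > -1" and k: "k \<in> {1..m}"
  shows "integrable (simplex_measure m) (simplex_integrand m (\<lambda>p. of_real (ln (p k))) n)"
proof -
  obtain d where "0 < d"
    "integrable (simplex_measure m) (simplex_integrand m (\<lambda>_. 1) (n(k := n k - of_real d)))"
    using integrable_simplex_integrand_1_lower[where n = n, OF assms] by blast
  from integrable_simplex_integrand_ln[OF k this(1) _ this(2)] show ?thesis by simp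
qed

text \<open>\<open>K\<close> collects the exponents that may be nonreal. To add \<open>k\<close>,
  the others are frozen: the difference of the two sides is holomorphic in exponent \<open>k\<close>
  on a half-plane and, by induction, zero on its real points.\<close>

lemma simplex_integral_1_real_outside:
  assumes m: "m \<ge> 1" and "finite K" "K \<subseteq> {1..m}"
    and "\<And>i. i \<in> {1..m} \<Longrightarrow> Re (n i) > -1"
    and "\<And>i. i \<in> {1..m} - K \<Longrightarrow> n i \<in> \<real>"
  shows "simplex_integral m (\<lambda>_. 1) n = dirichlet_constant m n"
  using assms(2-)
proof (induction K arbitrary: n rule: finite_induct)
  case empty
  then show ?case using simplex_integral_1_real[OF m] by simp
next
  case (insert k K)
  have k: "k \<in> {1..m}" using insert.prems by simp
  define S where "S = {z. -1 < Re z}"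
  define f where "f z = simplex_integral m (\<lambda>_. 1) (n(k := z)) - dirichlet_constant m (n(k := z))" for z
  have Re: "Re ((n(k := z)) i) > -1" if "z \<in> S" "i \<in> {1..m}" for z i
    using insert.prems(2)[OF that(2)] that(1) by (simp add: S_def)
  have "f (n k) = 0"
  proof (rule analytic_continuation[of f S "of_real ` {-1<..}" 0])
    show "open S" unfolding S_def by (rule open_halfspace_Re_gt)
    show "connected S" unfolding S_def by (intro convex_connected convex_halfspace_Re_gt)
    show "f holomorphic_on S"
    proof (rule holomorphic_onI)
      fix z assume z: "z \<in> S"
      let ?n = "n(k := z)"
      \<comment> \<open>Derivatives are available for a shift at 0, so the one at \<open>z\<close>
        is obtained by translation.\<close>
      have "((\<lambda>w. f (w + z)) has_field_derivative
          simplex_integral m (\<lambda>p. of_real (ln (p k))) ?n - dirichlet_constant m ?n *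
            (Digamma (?n k + 1) - Digamma (\<Sum>i\<in>{1..m}. ?n i + 1))) (at 0)"
        using DERIV_diff[OF has_field_derivative_simplex_integral_1[where n = ?n, OF m Re[OF z] k]
          has_field_derivative_dirichlet_constant[where n = ?n, OF m Re[OF z] k]]
        by (simp add: f_def add.commute)
      then have "(f has_field_derivative
          simplex_integral m (\<lambda>p. of_real (ln (p k))) ?n - dirichlet_constant m ?n *
            (Digamma (?n k + 1) - Digamma (\<Sum>i\<in>{1..m}. ?n i + 1))) (at z)"
        using DERIV_shift[of f _ 0 z] by simp
      then show "f field_differentiable at z within S"
        using field_differentiable_at_within field_differentiable_def by blast
    qed
    show "of_real ` {-1<..} \<subseteq> S" "0 \<in> S" "n k \<in> S"
      using insert.prems(2)[OF k] by (auto simp: S_def)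
    \<comment> \<open>The accumulation point required by the identity theorem.\<close>
    show "0 islimpt complex_of_real ` {-1<..}"
    proof -
      have "(0::real) islimpt {-1<..}" by (rule open_imp_islimpt) auto
      then show ?thesis
        by (simp add: islimpt_approachable)
    qed
    show "f z = 0" if "z \<in> of_real ` {-1<..}" for z
    proof -
      have "simplex_integral m (\<lambda>_. 1) (n(k := z)) = dirichlet_constant m (n(k := z))"
        using that insert.prems k by (intro insert.IH) auto
      then show ?thesis by (simp add: f_def)
    qed
  qed
  then show ?case by (simp add: f_def)
qed

lemma simplex_integral_1:
  assumes "m \<ge> 1" and "\<And>i. i \<in> {1..m} \<Longrightarrow> Re (n i) > -1"
  shows "simplex_integral m (\<lambda>_. 1) n = dirichlet_constant m n"
  using assms by (intro simplex_integral_1_real_outside[of m "{1..m}"]) auto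

section \<open>First and second logarithmic moments\<close>

text \<open>The conditions are open, so formulas for admissible exponents hold for all small shifts
  and may be differentiated.\<close>

lemma eventually_Re_gt_shift:
  assumes "\<And>i. i \<in> {1..m} \<Longrightarrow> Re (n i) > -1"
  shows "\<forall>\<^sub>F z in nhds 0. \<forall>i\<in>{1..m}. Re ((n(k := n k + z)) i) > -1"
proof (cases "k \<in> {1..m}")
  case True
  have "open {z. -1 - Re (n k) < Re z}" by (rule open_halfspace_Re_gt)
  moreover have "0 \<in> {z. -1 - Re (n k) < Re z}" using assms[OF True] by simp
  ultimately have "\<forall>\<^sub>F z in nhds 0. z \<in> {z. -1 - Re (n k) < Re z}" by (rule eventually_nhds_in_open)
  then show ?thesis
    by eventually_elim (use assms in auto)
qed (use assms in auto)

text \<open>One function of the shift is differentiated twice over, under the integral and through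
  the Gamma quotient; derivatives are unique.\<close>

lemma simplex_integral_ln:
  assumes m: "m \<ge> 1" and n: "\<And>i. i \<in> {1..m} \<Longrightarrow> Re (n i) > -1" and k: "k \<in> {1..m}"
  shows "simplex_integral m (\<lambda>p. of_real (ln (p k))) n =
    dirichlet_constant m n * (Digamma (n k + 1) - Digamma (\<Sum>i\<in>{1..m}. n i + 1))"
proof (rule DERIV_unique)
  show "((\<lambda>z. simplex_integral m (\<lambda>_. 1) (n(k := n k + z))) has_field_derivative
    simplex_integral m (\<lambda>p. of_real (ln (p k))) n) (at 0)"
    by (rule has_field_derivative_simplex_integral_1[where n = n, OF assms])
  have "\<forall>\<^sub>F z in nhds 0. \<forall>i\<in>{1..m}. Re ((n(k := n k + z)) i) > -1"
    using n by (rule eventually_Re_gt_shift)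
  then have ev: "\<forall>\<^sub>F z in nhds 0. simplex_integral m (\<lambda>_. 1) (n(k := n k + z)) =
      dirichlet_constant m (n(k := n k + z))"
    by eventually_elim (use simplex_integral_1[OF m] in blast)
  show "((\<lambda>z. simplex_integral m (\<lambda>_. 1) (n(k := n k + z))) has_field_derivative
    dirichlet_constant m n * (Digamma (n k + 1) - Digamma (\<Sum>i\<in>{1..m}. n i + 1))) (at 0)"
    unfolding DERIV_cong_ev[OF refl ev refl]
    by (rule has_field_derivative_dirichlet_constant[where n = n, OF assms])
qed

text \<open>The first-moment formula is differentiated once more, in exponent \<open>l\<close>. The
  total contributes \<open>- Polygamma 1 A\<close> always, while \<open>Digamma (n k + 1)\<close>
  varies with exponent \<open>l\<close> only if \<open>k = l\<close>.\<close>

lemma simplex_integral_ln_ln: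
  assumes m: "m \<ge> 1" and n: "\<And>i. i \<in> {1..m} \<Longrightarrow> Re (n i) > -1"
    and k: "k \<in> {1..m}" and l: "l \<in> {1..m}"
  defines "A \<equiv> \<Sum>i\<in>{1..m}. n i + 1"
  shows "simplex_integral m (\<lambda>p. of_real (ln (p l)) * of_real (ln (p k))) n =
    dirichlet_constant m n * ((Digamma (n k + 1) - Digamma A) * (Digamma (n l + 1) - Digamma A)
      + (if k = l then Polygamma 1 (n k + 1) else 0) - Polygamma 1 A)"
proof (rule DERIV_unique)
  obtain d where d: "0 < d" "\<And>i. i \<in> {1..m} \<Longrightarrow> Re ((n(l := n l - of_real d)) i) > -1"
    using integrable_simplex_integrand_1_lower[where n = n, OF m n l] by blast
  show "((\<lambda>z. simplex_integral m (\<lambda>p. of_real (ln (p k))) (n(l := n l + z))) has_field_derivative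
    simplex_integral m (\<lambda>p. of_real (ln (p l)) * of_real (ln (p k))) n) (at 0)"
    using k by (intro has_field_derivative_simplex_integral[OF l d(1)]
        integrable_simplex_integrand_ln_1[OF m d(2)] measurable_simplex_ln)
  have A: "A \<notin> \<int>\<^sub>\<le>\<^sub>0"
    unfolding A_def by (intro not_nonpos_Ints_if_Re_pos Re_sum_plus_one_pos assms)
  have nk: "n k + 1 \<notin> \<int>\<^sub>\<le>\<^sub>0"
    using n[OF k] by (intro not_nonpos_Ints_if_Re_pos) simp
  have "((\<lambda>z. Digamma ((n(l := n l + z)) k + 1)) has_field_derivative
      (if k = l then Polygamma 1 (n k + 1) else 0)) (at 0)"
    using nk by (cases "k = l") (auto intro!: derivative_eq_intros)
  moreover have "((\<lambda>z. Digamma (A + z)) has_field_derivative Polygamma 1 A) (at 0)"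
    using A by (auto intro!: derivative_eq_intros)
  \<comment> \<open>Product rule; the terms with \<open>+ 0\<close> are the factors evaluated at the
    base point.\<close>
  ultimately have deriv: "((\<lambda>z. dirichlet_constant m (n(l := n l + z)) *
      (Digamma ((n(l := n l + z)) k + 1) - Digamma (A + z))) has_field_derivative
    dirichlet_constant m n * (Digamma (n l + 1) - Digamma A) *
      (Digamma ((n(l := n l + 0)) k + 1) - Digamma (A + 0)) +
    ((if k = l then Polygamma 1 (n k + 1) else 0) - Polygamma 1 A) *
      dirichlet_constant m (n(l := n l + 0))) (at 0)"
    using has_field_derivative_dirichlet_constant[where n = n, OF m n l]
    unfolding A_def[symmetric] by (intro DERIV_mult DERIV_diff)
  have "\<forall>\<^sub>F z in nhds 0. \<forall>i\<in>{1..m}. Re ((n(l := n l + z)) i) > -1"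
    using n by (rule eventually_Re_gt_shift)
  then have ev: "\<forall>\<^sub>F z in nhds 0. simplex_integral m (\<lambda>p. of_real (ln (p k))) (n(l := n l + z)) =
      dirichlet_constant m (n(l := n l + z)) * (Digamma ((n(l := n l + z)) k + 1) - Digamma (A + z))"
  proof eventually_elim
    case (elim z)
    then show ?case
      using simplex_integral_ln[OF m _ k, of "n(l := n l + z)"]
      unfolding sum_plus_one_shift[OF l] A_def by blast
  qed
  have "((\<lambda>z. simplex_integral m (\<lambda>p. of_real (ln (p k))) (n(l := n l + z))) has_field_derivative
    dirichlet_constant m n * (Digamma (n l + 1) - Digamma A) *
      (Digamma ((n(l := n l + 0)) k + 1) - Digamma (A + 0)) +
    ((if k = l then Polygamma 1 (n k + 1) else 0) - Polygamma 1 A) *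
      dirichlet_constant m (n(l := n l + 0))) (at 0)"
    by (rule DERIV_cong_ev[OF refl ev refl, THEN iffD2, OF deriv])
  then show "((\<lambda>z. simplex_integral m (\<lambda>p. of_real (ln (p k))) (n(l := n l + z))) has_field_derivative
    dirichlet_constant m n * ((Digamma (n k + 1) - Digamma A) * (Digamma (n l + 1) - Digamma A)
      + (if k = l then Polygamma 1 (n k + 1) else 0) - Polygamma 1 A)) (at 0)"
    by (rule DERIV_cong) (simp add: algebra_simps)
qed

section \<open>Reduction of the squared entropy to logarithmic moments\<close>

text \<open>The shift factor \<open>exp (ln (p k))\<close> is \<open>p k\<close> only for a positive
  coordinate, since \<open>ln 0 = 0\<close> would give 1. At a zero coordinate both weights vanish
  because \<open>0 powr c = 0\<close>.\<close>

lemma simplex_weight_plus_one: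
  assumes x: "x \<in> simplex_region m" and k: "k \<in> {1..m}"
  shows "simplex_weight m (n(k := n k + 1)) x = of_real (simplex_point m x k) * simplex_weight m n x"
proof (cases "simplex_point m x k = 0")
  case True
  then have "simplex_weight m n x = 0" for n
    using k by (auto simp: simplex_weight_def)
  then show ?thesis by simp
next
  case False
  then have "0 < simplex_point m x k" using simplex_point_range(1)[OF assms] by simp
  then show ?thesis using simplex_weight_shift[OF assms, of n 1] by (simp add: exp_of_real)
qed

text \<open>The square expands into products of \<open>p i * ln (p i)\<close> and
  \<open>p j * ln (p j)\<close>, whose non-logarithmic factors go into the weight. The nested
  updates in \<open>n2\<close> raise exponent \<open>i\<close> by two when
  \<open>i = j\<close>.\<close>

lemma simplex_integral_shannon_entropy_sq:
  fixes m :: nat and n :: "nat \<Rightarrow> complex"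
  assumes m: "m \<ge> 1" and n: "\<And>i. i \<in> {1..m} \<Longrightarrow> Re (n i) > -1"
  defines "n1 \<equiv> \<lambda>i. n(i := n i + 1)"
  defines "n2 \<equiv> \<lambda>i j. (n1 i)(j := n1 i j + 1)"
  shows "simplex_integral m (\<lambda>p. of_real ((shannon_entropy m p)\<^sup>2)) n =
    (\<Sum>i\<in>{1..m}. \<Sum>j\<in>{1..m}. simplex_integral m (\<lambda>p. of_real (ln (p i)) * of_real (ln (p j))) (n2 i j))"
proof -
  define G where "G i j = (\<lambda>p :: nat \<Rightarrow> real. complex_of_real (ln (p i)) * of_real (ln (p j)))" for i j
  have integrable: "integrable (simplex_measure m) (simplex_integrand m (G i j) (n2 i j))"
    if i: "i \<in> {1..m}" and j: "j \<in> {1..m}" for i j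
  proof -
    have n2: "Re (n2 i j k) > -1" if "k \<in> {1..m}" for k
      using n[OF that] by (auto simp: n1_def n2_def)
    \<comment> \<open>Lowering exponent \<open>i\<close> by \<open>d\<close> pays for
      \<open>ln (p i)\<close>; \<open>ln (p j)\<close> is integrable at the lowered exponents as
      well.\<close>
    obtain d where d: "0 < d" "\<And>k. k \<in> {1..m} \<Longrightarrow> Re (((n2 i j)(i := n2 i j i - of_real d)) k) > -1"
      using integrable_simplex_integrand_1_lower[where n = "n2 i j", OF m n2 i] by blast
    show ?thesis
      unfolding G_def using j by (intro integrable_simplex_integrand_ln[OF i d(1)]
          integrable_simplex_integrand_ln_1[OF m d(2)] measurable_simplex_ln)
  qed
  have "simplex_integrand m (\<lambda>p. of_real ((shannon_entropy m p)\<^sup>2)) n x =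
      (\<Sum>i\<in>{1..m}. \<Sum>j\<in>{1..m}. simplex_integrand m (G i j) (n2 i j) x)" for x
  proof (cases "x \<in> simplex_region m")
    case True
    define p where "p = simplex_point m x"
    have "simplex_integrand m (G i j) (n2 i j) x =
        of_real (p i * ln (p i)) * of_real (p j * ln (p j)) * simplex_weight m n x"
      if "i \<in> {1..m}" "j \<in> {1..m}" for i j
      using that True simplex_weight_plus_one[OF True, of j "n1 i"] simplex_weight_plus_one[OF True, of i n]
      by (simp add: simplex_integrand_def G_def p_def n1_def n2_def)
    then have "(\<Sum>i\<in>{1..m}. \<Sum>j\<in>{1..m}. simplex_integrand m (G i j) (n2 i j) x) =
        (\<Sum>i\<in>{1..m}. \<Sum>j\<in>{1..m}. of_real (p i * ln (p i)) * of_real (p j * ln (p j)) * simplex_weight m n x)"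
      by (intro sum.cong refl)
    also have "\<dots> = (\<Sum>i\<in>{1..m}. of_real (p i * ln (p i))) * (\<Sum>j\<in>{1..m}. of_real (p j * ln (p j)))
        * simplex_weight m n x"
      by (subst sum_product) (simp only: sum_distrib_right)
    \<comment> \<open>The sign of the entropy disappears in the square.\<close>
    also have "\<dots> = of_real ((shannon_entropy m p)\<^sup>2) * simplex_weight m n x"
      by (simp add: shannon_entropy_def power2_eq_square)
    finally show ?thesis using True by (simp add: simplex_integrand_def p_def)
  qed (simp add: simplex_integrand_def)
  then have "simplex_integral m (\<lambda>p. of_real ((shannon_entropy m p)\<^sup>2)) n =
      (\<integral>x. (\<Sum>i\<in>{1..m}. \<Sum>j\<in>{1..m}. simplex_integrand m (G i j) (n2 i j) x) \<partial>simplex_measure m)"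
    unfolding simplex_integral_eq by (intro Bochner_Integration.integral_cong) auto
  also have "\<dots> = (\<Sum>i\<in>{1..m}. \<Sum>j\<in>{1..m}. simplex_integral m (G i j) (n2 i j))"
    unfolding simplex_integral_eq
    by (subst Bochner_Integration.integral_sum)
       (auto intro!: sum.cong Bochner_Integration.integral_sum integrable integrable_sum
         simp del: One_nat_def)
  finally show ?thesis unfolding G_def .
qed

section \<open>Assembly of the estimator\<close>

text \<open>The indices differ by one: \<open>Phi\<close> counts derivatives of
  \<open>ln_Gamma\<close>, \<open>Polygamma\<close> those of \<open>Digamma\<close>. The right
  half-plane avoids the branch cut.\<close>

lemma Phi_eq_Polygamma:
  assumes "0 < Re z"
  shows "Phi 1 z = Digamma z" "Phi 2 z = Polygamma 1 z"
  unfolding Phi_def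
  using higher_deriv_ln_Gamma_complex[OF not_nonpos_Reals_if_Re_pos[OF assms], of 1]
    higher_deriv_ln_Gamma_complex[OF not_nonpos_Reals_if_Re_pos[OF assms], of 2]
  by simp_all

theorem theorem8:
  fixes m :: nat and n :: "nat \<Rightarrow> complex" and N :: complex
  assumes "m \<ge> 1"
    and "\<And>i. i \<in> {1..m} \<Longrightarrow> Re (n i) > -1"
    and "N = (\<Sum>i\<in>{1..m}. n i)"
  shows "simplex_integral m (\<lambda>p. of_real ((shannon_entropy m p)\<^sup>2)) n
           / simplex_integral m (\<lambda>p. 1) n =
         (\<Sum>i\<in>{1..m}. \<Sum>j\<in>{1..m} - {i}.
            (n i + 1) * (n j + 1) / ((N + of_nat m) * (N + of_nat m + 1)) *
            (Delta_Phi 1 (n i + 2) (N + of_nat m + 2) * Delta_Phi 1 (n j + 2) (N + of_nat m + 2)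
               - Phi 2 (N + of_nat m + 2)))
         + (\<Sum>i\<in>{1..m}.
            (n i + 1) * (n i + 2) / ((N + of_nat m) * (N + of_nat m + 1)) *
            ((Delta_Phi 1 (n i + 3) (N + of_nat m + 2))\<^sup>2
               + Delta_Phi 2 (n i + 3) (N + of_nat m + 2)))"
proof -
  note m = assms(1) and n = assms(2)
  define A where "A = N + of_nat m"
  have A: "(\<Sum>i\<in>{1..m}. n i + 1) = A"
    by (simp add: A_def assms(3) sum.distrib)
  have ReA: "0 < Re A" using Re_sum_plus_one_pos[where n = n, OF m n] by (simp only: A)
  define n1 where "n1 = (\<lambda>i. n(i := n i + 1))"
  define n2 where "n2 = (\<lambda>i j. (n1 i)(j := n1 i j + 1))"
  \<comment> \<open>The normalized contribution of the ordered pair \<open>(i, j)\<close>.\<close>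
  define T where "T i j = simplex_integral m (\<lambda>p. of_real (ln (p i)) * of_real (ln (p j))) (n2 i j)
      / dirichlet_constant m n" for i j
  \<comment> \<open>Two unit raises turn the total \<open>A\<close> into \<open>A + 2\<close>, the
    common second argument N + m + 2. The prefactor covers both cases, as \<open>n1 i j\<close> is
    \<open>n j\<close> off the diagonal and \<open>n i + 1\<close> on it.\<close>
  have T: "T i j = (n i + 1) * (n1 i j + 1) / (A * (A + 1)) *
      ((Digamma (n2 i j j + 1) - Digamma (A + 2)) * (Digamma (n2 i j i + 1) - Digamma (A + 2))
        + (if j = i then Polygamma 1 (n2 i j j + 1) else 0) - Polygamma 1 (A + 2))"
    if i: "i \<in> {1..m}" and j: "j \<in> {1..m}" for i j
  proof -
    have Re1: "Re (n1 i k) > -1" if "k \<in> {1..m}" for k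
      using n[OF that] by (auto simp: n1_def)
    have Re2: "Re (n2 i j k) > -1" if "k \<in> {1..m}" for k
      using Re1[OF that] by (auto simp: n2_def)
    have A1: "(\<Sum>k\<in>{1..m}. n1 i k + 1) = A + 1"
      unfolding n1_def sum_plus_one_shift[OF i] A ..
    have A2: "(\<Sum>k\<in>{1..m}. n2 i j k + 1) = A + 2"
      unfolding n2_def sum_plus_one_shift[OF j] A1 by simp
    have "dirichlet_constant m (n2 i j) = (n1 i j + 1) / (A + 1) * dirichlet_constant m (n1 i)"
      unfolding n2_def
      using dirichlet_constant_plus_one[where n = "n1 i", OF m Re1 j] by (simp only: A1)
    also have "dirichlet_constant m (n1 i) = (n i + 1) / A * dirichlet_constant m n"
      unfolding n1_def
      using dirichlet_constant_plus_one[where n = n, OF m n i] by (simp only: A)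
    finally have "dirichlet_constant m (n2 i j) / dirichlet_constant m n =
        (n i + 1) * (n1 i j + 1) / (A * (A + 1))"
      using dirichlet_constant_nonzero[where n = n, OF m n] by (simp add: mult_ac)
    moreover have "T i j = dirichlet_constant m (n2 i j) / dirichlet_constant m n *
      ((Digamma (n2 i j j + 1) - Digamma (A + 2)) * (Digamma (n2 i j i + 1) - Digamma (A + 2))
        + (if j = i then Polygamma 1 (n2 i j j + 1) else 0) - Polygamma 1 (A + 2))"
      unfolding T_def using simplex_integral_ln_ln[where n = "n2 i j", OF m Re2 j i]
      by (simp only: A2 times_divide_eq_left)
    ultimately show ?thesis by (simp only:)
  qed
  \<comment> \<open>Both exponents are raised once, hence \<open>n i + 2\<close> and
    \<open>n j + 2\<close>; only the trigamma term of the total remains.\<close>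
  have off_diagonal: "T i j = (n i + 1) * (n j + 1) / (A * (A + 1)) *
      (Delta_Phi 1 (n i + 2) (A + 2) * Delta_Phi 1 (n j + 2) (A + 2) - Phi 2 (A + 2))"
    if "i \<in> {1..m}" "j \<in> {1..m} - {i}" for i j
    using that T[of i j] n[of i] n[of j] ReA
    by (simp add: n1_def n2_def Delta_Phi_def Phi_eq_Polygamma[unfolded One_nat_def] add.assoc mult.commute)
  \<comment> \<open>The exponent is raised twice, hence \<open>n i + 3\<close>; the two trigamma
    terms combine into \<open>Delta_Phi 2\<close>.\<close>
  have diagonal: "T i i = (n i + 1) * (n i + 2) / (A * (A + 1)) *
      ((Delta_Phi 1 (n i + 3) (A + 2))\<^sup>2 + Delta_Phi 2 (n i + 3) (A + 2))"
    if "i \<in> {1..m}" for i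
    using that T[of i i] n[of i] ReA
    by (simp add: n1_def n2_def Delta_Phi_def Phi_eq_Polygamma[unfolded One_nat_def] add.assoc power2_eq_square add_diff_eq)
  have "simplex_integral m (\<lambda>p. of_real ((shannon_entropy m p)\<^sup>2)) n
      / simplex_integral m (\<lambda>p. 1) n = (\<Sum>i\<in>{1..m}. \<Sum>j\<in>{1..m}. T i j)"
    unfolding T_def n2_def n1_def
    using simplex_integral_shannon_entropy_sq[where n = n, OF m n] simplex_integral_1[where n = n, OF m n]
    by (simp only: sum_divide_distrib)
  also have "\<dots> = (\<Sum>i\<in>{1..m}. T i i + (\<Sum>j\<in>{1..m} - {i}. T i j))"
    by (intro sum.cong refl sum.remove) auto
  also have "\<dots> = (\<Sum>i\<in>{1..m}. \<Sum>j\<in>{1..m} - {i}. T i j) + (\<Sum>i\<in>{1..m}. T i i)"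
    by (simp add: sum.distrib)
  finally show ?thesis
    by (simp add: off_diagonal diagonal flip: A_def)
qed

end
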